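(* (i) Let $\Psi(\lambda)$, $0<\lambda<\infty$, be a concave and strictly increasing index function satisfying $$\lim_{\lambda\to+0}\Psi(\lambda)=0,\qquad \lim_{\lambda\to\infty}\Psi(\lambda)=\infty,\qquad \lim_{\lambda\to\infty}\frac{\Psi(\lambda)}{\lambda}=0 .$$ Then for the rate function $\bar\psi(t):=1/\sqrt{t\,\Psi^{-1}(1/t)}$ and $\Theta(t):=\sqrt t\,\bar\psi(t)$, $0<t<\infty$, we have $$\delta\sqrt{\Psi\left(\frac{R^2}{\delta^2}\right)}=R\,\bar\psi\left(\Theta^{-1}\left(\frac{\delta}{R}\right)\right),\qquad R>0,\ \delta>0. \qquad ( * )$$ Moreover, the function $t\mapsto\bar\psi^2((\Theta^2)^{-1}(t))$ is concave for all $0<t<\infty$. (ii) Vice versa, any rate function $\bar\psi(t)$, $0<t<\infty$, determines by the equation $$\bar\psi(t)=\frac{1}{\sqrt{t\,\Psi^{-1}(1/t)}},\qquad 0<t<\infty,$$ in a unique manner a strictly increasing index function $\Psi(\lambda)$, $0<\lambda<\infty$, satisfying the limit conditions $\lim_{\lambda\to+0}\Psi(\lambda)=0$, $\lim_{\lambda\to\infty}\Psi(\lambda)=\infty$ and $\lim_{\lambda\to\infty}\Psi(\lambda)/\lambda=0$. With $\Theta(t):=\sqrt t\,\bar\psi(t)$, if $\bar\psi^2((\Theta^2)^{-1}(t))$ is concave for all $0<t<\infty$, then $\Psi$ is concave for all $0<\lambda<\infty$, and again the coincidence $( * )$ holds.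
   Context: An index function is a continuous function $(0,\infty)\to(0,\infty)$. A rate function is an index function $\bar\theta$ that is monotonically increasing (non-strictly) with $\lim_{t\to+0}\bar\theta(t)=0$. $\Psi^{-1}$, $\Theta^{-1}$ and $(\Theta^2)^{-1}$ denote inverse functions (of $\Psi$, $\Theta$, and $t\mapsto\Theta(t)^2$), and $\bar\psi^2(\cdot)=(\bar\psi(\cdot))^2$. (The two sides of $( * )$ are two upper bounds for the modulus of continuity of the inverse of a bounded operator; concavity of $\Psi$, respectively of $\bar\psi^2((\Theta^2)^{-1}(\cdot))$, is the condition under which each bound is obtained.) *)

theory Defs
  imports "HOL-Analysis.Analysis"
begin

text \<open>
  Functions on the positive half-line are total functions of type \<open>real \<Rightarrow> real\<close>; only their
  values on \<open>{0<..}\<close> matter.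
\<close>

definition index_function :: "(real \<Rightarrow> real) \<Rightarrow> bool" where
  "index_function f \<longleftrightarrow> continuous_on {0<..} f \<and> (\<forall>t>0. f t > 0)"

definition rate_function :: "(real \<Rightarrow> real) \<Rightarrow> bool" where
  "rate_function f \<longleftrightarrow>
     index_function f \<and> mono_on {0<..} f \<and> (f \<longlongrightarrow> 0) (at_right 0)"

definition limit_conditions :: "(real \<Rightarrow> real) \<Rightarrow> bool" where
  "limit_conditions \<Psi> \<longleftrightarrow>
     (\<Psi> \<longlongrightarrow> 0) (at_right 0) \<and> filterlim \<Psi> at_top at_top \<and> ((\<lambda>x. \<Psi> x / x) \<longlongrightarrow> 0) at_top"

text \<open>
  \<open>pos_inv f\<close> is the inverse function of \<open>f\<close> on the positive half-line. It is meaningful only if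
  \<open>f\<close> maps \<open>{0<..}\<close> bijectively onto itself, which is what \<open>pos_invertible\<close> records.
\<close>

definition pos_invertible :: "(real \<Rightarrow> real) \<Rightarrow> bool" where
  "pos_invertible f \<longleftrightarrow> bij_betw f {0<..} {0<..}"

definition pos_inv :: "(real \<Rightarrow> real) \<Rightarrow> real \<Rightarrow> real" where
  "pos_inv f = inv_into {0<..} f"

definition psi_bar :: "(real \<Rightarrow> real) \<Rightarrow> real \<Rightarrow> real" where
  "psi_bar \<Psi> t = 1 / sqrt (t * pos_inv \<Psi> (1 / t))"

definition Theta :: "(real \<Rightarrow> real) \<Rightarrow> real \<Rightarrow> real" where
  "Theta \<psi> t = sqrt t * \<psi> t"

definition Theta_sq :: "(real \<Rightarrow> real) \<Rightarrow> real \<Rightarrow> real" where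
  "Theta_sq \<psi> t = (Theta \<psi> t)\<^sup>2"

definition coincidence :: "(real \<Rightarrow> real) \<Rightarrow> (real \<Rightarrow> real) \<Rightarrow> bool" where
  "coincidence \<Psi> \<psi> \<longleftrightarrow>
     (\<forall>R>0. \<forall>\<delta>>0. \<delta> * sqrt (\<Psi> (R\<^sup>2 / \<delta>\<^sup>2)) = R * \<psi> (pos_inv (Theta \<psi>) (\<delta> / R)))"

end

(*
  If Psi is an increasing bijection of the positive half-line and psi is the associated rate
  function, then Theta^2(t) = t psi(t)^2 = 1 / Psi^{-1}(1/t). So the inverse of Theta^2 is
  x |-> 1 / Psi(1/x), and psi^2 composed with this inverse is x Psi(1/x). This turns the coincidence of the two bounds into an
  identity, and concavity passes in both directions because x Psi(1/x) is the perspective of Psi,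
  an involution preserving concavity. Conversely, Psi is recovered from psi as
  1 / (Theta^2)^{-1}(1/x), and its growth condition comes from Psi(x)/x = psi(1/Psi(x))^2.
*)

theory Submission
  imports Defs
begin

section \<open>Order isomorphisms of the positive half-line\<close>

text \<open>Continuity and the limits at 0 and at infinity all follow from these two properties, so
  this one predicate serves for \<open>\<Psi>\<close>, its inverse, \<open>Theta\<close> and
  \<open>Theta_sq\<close> alike.\<close>

definition pos_order_iso :: "(real \<Rightarrow> real) \<Rightarrow> bool" where
  "pos_order_iso f \<longleftrightarrow> strict_mono_on {0<..} f \<and> bij_betw f {0<..} {0<..}"

lemma pos_order_isoI:
  assumes "\<And>x. x > 0 \<Longrightarrow> f x > 0" "\<And>x y. 0 < x \<Longrightarrow> x < y \<Longrightarrow> f x < f y"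
    and "\<And>y. y > 0 \<Longrightarrow> \<exists>x>0. f x = y"
  shows "pos_order_iso f"
  unfolding pos_order_iso_def
proof
  show "strict_mono_on {0<..} f"
    using assms(2) by (auto intro: strict_mono_onI)
  then show "bij_betw f {0<..} {0<..}"
    using assms(1,3) by (auto simp: bij_betw_def strict_mono_on_imp_inj_on)
qed

context
  fixes f :: "real \<Rightarrow> real"
  assumes iso: "pos_order_iso f"
begin

lemma pos_order_iso_imp_invertible: "pos_invertible f"
  using iso by (simp add: pos_order_iso_def pos_invertible_def)

lemma pos_order_iso_pos: "x > 0 \<Longrightarrow> f x > 0"
  using iso by (auto simp: pos_order_iso_def bij_betw_def)

lemma pos_order_iso_less_iff: "x > 0 \<Longrightarrow> y > 0 \<Longrightarrow> f x < f y \<longleftrightarrow> x < y"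
  using iso unfolding pos_order_iso_def
  by (metis greaterThan_iff linorder_neq_iff order_less_asym strict_mono_onD)

lemma pos_inv_pos: "y > 0 \<Longrightarrow> pos_inv f y > 0"
  and f_pos_inv: "y > 0 \<Longrightarrow> f (pos_inv f y) = y"
  and pos_inv_f: "x > 0 \<Longrightarrow> pos_inv f (f x) = x"
  using iso unfolding pos_order_iso_def pos_inv_def bij_betw_def
  by (metis greaterThan_iff inv_into_into, metis f_inv_into_f greaterThan_iff,
      metis greaterThan_iff inv_into_f_f)

lemma pos_inv_eqI: "x > 0 \<Longrightarrow> f x = y \<Longrightarrow> pos_inv f y = x"
  using pos_inv_f by auto

lemma pos_order_iso_pos_inv: "pos_order_iso (pos_inv f)"
proof (rule pos_order_isoI)
  fix x y :: real
  assume "0 < x" "x < y"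
  then show "pos_inv f x < pos_inv f y"
    using pos_order_iso_less_iff[of "pos_inv f x" "pos_inv f y"] by (simp add: pos_inv_pos f_pos_inv)
qed (use pos_inv_pos pos_inv_f pos_order_iso_pos in blast)+

text \<open>A discontinuity of a monotone function would be a jump and leave a gap in its image;
  here the image is the whole open half-line.\<close>

lemma pos_order_iso_continuous: "continuous_on {0<..} f"
proof (rule continuous_onI_mono)
  show "open (f ` {0<..})"
    using iso by (simp add: pos_order_iso_def bij_betw_def)
  show "f x \<le> f y" if "x \<in> {0<..}" "y \<in> {0<..}" "x \<le> y" for x y
    using that pos_order_iso_less_iff[of y x] by (simp add: not_less[symmetric])
qed

lemma pos_order_iso_index_function: "index_function f"
  by (simp add: index_function_def pos_order_iso_continuous pos_order_iso_pos)

lemma pos_order_iso_at_top: "filterlim f at_top at_top"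
  unfolding filterlim_at_top
proof
  fix Z :: real
  \<comment> \<open>\<open>Z\<close> may be nonpositive; the maximum with 1 keeps the argument in
    the domain of the inverse.\<close>
  define m where "m = pos_inv f (max Z 1)"
  have m: "m > 0" "f m = max Z 1"
    by (simp_all add: m_def pos_inv_pos f_pos_inv)
  have "Z \<le> f x" if "x > m" for x
    using pos_order_iso_less_iff[of m x] that m by simp
  then show "\<forall>\<^sub>F x in at_top. Z \<le> f x"
    using eventually_gt_at_top by (rule eventually_mono[rotated])
qed

lemma pos_order_iso_at_0: "(f \<longlongrightarrow> 0) (at_right 0)"
proof (rule order_tendstoI)
  fix a :: real
  assume "a < 0"
  then show "\<forall>\<^sub>F x in at_right 0. a < f x"
    using pos_order_iso_pos by (force intro: eventually_mono[OF eventually_at_right_less])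
next
  fix a :: real
  assume "0 < a"
  then have "f x < a" if "0 < x" "x < pos_inv f a" for x
    using pos_order_iso_less_iff[of x "pos_inv f a"] that by (simp add: f_pos_inv)
  then show "\<forall>\<^sub>F x in at_right 0. f x < a"
    unfolding eventually_at_right_field using pos_inv_pos[OF \<open>0 < a\<close>] by blast
qed

end

text \<open>Surjectivity comes from the intermediate value theorem: the two limits supply points
  where \<open>f\<close> lies below and above any prescribed \<open>y\<close>.\<close>

lemma pos_order_iso_of_limits:
  assumes "continuous_on {0<..} f" "strict_mono_on {0<..} f" "\<And>x. x > 0 \<Longrightarrow> f x > 0"
    and "(f \<longlongrightarrow> 0) (at_right 0)" "filterlim f at_top at_top"
  shows "pos_order_iso f"
proof (rule pos_order_isoI)
  fix y :: real
  assume "y > 0"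
  with assms(4) have "\<forall>\<^sub>F x in at_right 0. f x < y \<and> 0 < x"
    by (auto simp: order_tendsto_iff intro: eventually_conj eventually_at_right_less)
  then obtain a where a: "f a < y" "a > 0"
    by (auto dest: eventually_happens)
  have "\<forall>\<^sub>F x in at_top. y \<le> f x \<and> a \<le> x"
    using assms(5) by (auto simp: filterlim_at_top intro: eventually_conj eventually_ge_at_top)
  then obtain b where b: "y \<le> f b" "a \<le> b"
    by (auto dest: eventually_happens)
  have "continuous_on {a..b} f"
    using assms(1) by (rule continuous_on_subset) (use a in auto)
  then show "\<exists>x>0. f x = y"
    using IVT'[of f a y b] a b by (metis less_le less_le_trans)
next
  show "f x < f y" if "0 < x" "x < y" for x y
    using strict_mono_onD[OF assms(2)] that by simp
qed (rule assms(3))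

section \<open>Concave functions on the half-line: perspective and ratio\<close>

lemma concave_on_perspective:
  assumes "concave_on {0<..} f"
  shows "concave_on {0<..} (\<lambda>t::real. t * f (1 / t))"
  unfolding concave_on_iff
proof (intro conjI ballI allI impI)
  fix x y u v :: real
  assume "x \<in> {0<..}" "y \<in> {0<..}" and uv: "0 \<le> u" "0 \<le> v" "u + v = 1"
  then have xy: "x > 0" "y > 0"
    by auto
  define z where "z = u * x + v * y"
  have z: "z > 0"
    using xy uv unfolding z_def
    by (metis add_nonneg_pos add_pos_nonneg add_0 less_eq_real_def mult_nonneg_nonneg mult_pos_pos zero_less_one)
  \<comment> \<open>These reweighted coefficients average the points \<open>1 / x\<close> and
    \<open>1 / y\<close> to exactly \<open>1 / z\<close>. Concavity of \<open>f\<close> there,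
    multiplied by \<open>z\<close>, is the claim.\<close>
  have "u * x / z + v * y / z = 1"
    using z by (simp add: z_def flip: add_divide_distrib)
  then have "(u * x / z) * f (1 / x) + (v * y / z) * f (1 / y)
      \<le> f ((u * x / z) *\<^sub>R (1 / x) + (v * y / z) *\<^sub>R (1 / y))"
    using assms[unfolded concave_on_iff, THEN conjunct2, rule_format, of "1 / x" "1 / y" "u * x / z" "v * y / z"]
      xy uv z by simp
  also have "(u * x / z) *\<^sub>R (1 / x) + (v * y / z) *\<^sub>R (1 / y) = 1 / z"
    using xy z uv by (simp add: add_divide_distrib[symmetric])
  finally show "u * (x * f (1 / x)) + v * (y * f (1 / y))
      \<le> (u *\<^sub>R x + v *\<^sub>R y) * f (1 / (u *\<^sub>R x + v *\<^sub>R y))"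
    using z by (simp add: z_def[symmetric] field_simps)
qed simp

text \<open>The inequality also evaluates the functions at a convex combination; it stays in
  \<open>S\<close> because \<open>concave_on\<close> includes convexity of \<open>S\<close>.\<close>

lemma concave_on_cong:
  assumes "\<And>x. x \<in> S \<Longrightarrow> f x = g x"
  shows "concave_on S f \<longleftrightarrow> concave_on S g"
  using assms by (auto simp: concave_on_iff convexD)

lemma concave_on_perspective_iff:
  "concave_on {0<..} (\<lambda>t::real. t * f (1 / t)) \<longleftrightarrow> concave_on {0<..} f"
proof
  assume "concave_on {0<..} (\<lambda>t. t * f (1 / t))"
  then have "concave_on {0<..} (\<lambda>t. t * ((1 / t) * f (1 / (1 / t))))"
    by (rule concave_on_perspective)
  then show "concave_on {0<..} f"
    by (rule iffD1[OF concave_on_cong, rotated]) auto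
qed (rule concave_on_perspective)

text \<open>For a concave function with value at least 0 at the origin, slopes of chords from the
  origin decrease. Since 0 lies outside the domain, chords start at a small \<open>e > 0\<close>
  instead, the positive value \<open>f e\<close> is dropped, and \<open>e\<close> tends to
  0.\<close>

lemma concave_on_pos_ratio_antimono:
  fixes f :: "real \<Rightarrow> real"
  assumes "concave_on {0<..} f" "\<And>x. x > 0 \<Longrightarrow> f x > 0" "0 < a" "a \<le> b"
  shows "f b / b \<le> f a / a"
proof (cases "a = b")
  case False
  with assms have "a < b"
    by simp
  have "(a - e) * f b \<le> (b - e) * f a" if e: "0 < e" "e < a" for e
  proof -
    \<comment> \<open>The weight that writes \<open>a\<close> as a convex combination of
      \<open>e\<close> and \<open>b\<close>.\<close>
    define u where "u = (a - e) / (b - e)"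
    have u: "0 \<le> u" "u \<le> 1" "u * (b - e) = a - e"
      using e \<open>a < b\<close> by (auto simp: u_def)
    have "(1 - u) * f e + u * f b \<le> f ((1 - u) *\<^sub>R e + u *\<^sub>R b)"
      using assms u e unfolding concave_on_iff by force
    also have "(1 - u) *\<^sub>R e + u *\<^sub>R b = a"
      using u(3) by (simp add: algebra_simps)
    finally have "u * f b \<le> f a"
      using assms(2)[of e] e u mult_nonneg_nonneg[of "1 - u" "f e"] by linarith
    then have "(b - e) * (u * f b) \<le> (b - e) * f a"
      using e \<open>a < b\<close> by (intro mult_left_mono) auto
    then show ?thesis
      using u(3) by (simp add: mult.assoc[symmetric] mult.commute[of _ u])
  qed
  then have "\<forall>\<^sub>F e in at_right 0. (a - e) * f b \<le> (b - e) * f a"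
    unfolding eventually_at_right_field using \<open>0 < a\<close> by blast
  moreover have "((\<lambda>e. (a - e) * f b) \<longlongrightarrow> (a - 0) * f b) (at_right 0)"
    and "((\<lambda>e. (b - e) * f a) \<longlongrightarrow> (b - 0) * f a) (at_right 0)"
    by (intro tendsto_intros)+
  ultimately have "a * f b \<le> b * f a"
    using tendsto_le[OF trivial_limit_at_right_real] by force
  then show ?thesis
    using assms(3) \<open>a < b\<close> by (simp add: field_simps)
qed simp

section \<open>Inverses of \<open>Theta\<close> and \<open>Theta_sq\<close>, and the
  coincidence\<close>

lemma psi_bar_pos: "pos_order_iso \<Psi> \<Longrightarrow> t > 0 \<Longrightarrow> psi_bar \<Psi> t > 0"
  by (simp add: psi_bar_def pos_inv_pos)

context
  fixes \<Psi> \<psi> :: "real \<Rightarrow> real"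
  assumes \<Psi>: "pos_order_iso \<Psi>" and \<psi>: "\<And>t. t > 0 \<Longrightarrow> \<psi> t = psi_bar \<Psi> t"
begin

text \<open>The factor \<open>t\<close> cancels against the one under the root. As
  \<open>\<psi>\<close> need only agree with \<open>psi_bar \<Psi>\<close> on positive arguments,
  this context covers both \<open>psi_bar \<Psi>\<close> itself and a given rate function from which
  \<open>\<Psi>\<close> is constructed.\<close>

lemma Theta_sq_psi_bar: "t > 0 \<Longrightarrow> Theta_sq \<psi> t = 1 / pos_inv \<Psi> (1 / t)"
  by (simp add: Theta_sq_def Theta_def \<psi> psi_bar_def power_mult_distrib power_divide
      pos_inv_pos[OF \<Psi>] less_imp_le)

lemma Theta_eq_sqrt_Theta_sq: "t > 0 \<Longrightarrow> Theta \<psi> t = sqrt (Theta_sq \<psi> t)"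
  using psi_bar_pos[OF \<Psi>] by (simp add: Theta_sq_def Theta_def \<psi> less_imp_le)

text \<open>The argument solves \<open>1 / pos_inv \<Psi> (1 / t) = x\<close> for \<open>t\<close>.
  It is the witness for surjectivity of \<open>Theta_sq\<close> and afterwards the value of its
  inverse.\<close>

lemma Theta_sq_recip:
  assumes "x > 0"
  shows "Theta_sq \<psi> (1 / \<Psi> (1 / x)) = x"
  using assms pos_order_iso_pos[OF \<Psi>] by (simp add: Theta_sq_psi_bar pos_inv_f[OF \<Psi>])

lemma Theta_recip: "x > 0 \<Longrightarrow> Theta \<psi> (1 / \<Psi> (1 / x\<^sup>2)) = x"
  using pos_order_iso_pos[OF \<Psi>] by (simp add: Theta_eq_sqrt_Theta_sq Theta_sq_recip)

lemma Theta_sq_less: "0 < x \<Longrightarrow> x < y \<Longrightarrow> Theta_sq \<psi> x < Theta_sq \<psi> y"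
  using pos_order_iso_less_iff[OF pos_order_iso_pos_inv[OF \<Psi>], of "1 / y" "1 / x"]
  by (simp add: Theta_sq_psi_bar pos_inv_pos[OF \<Psi>] frac_less2)

lemma pos_order_iso_Theta_sq: "pos_order_iso (Theta_sq \<psi>)"
proof (rule pos_order_isoI)
  show "Theta_sq \<psi> x > 0" if "x > 0" for x
    using that by (simp add: Theta_sq_psi_bar pos_inv_pos[OF \<Psi>])
  show "\<exists>x>0. Theta_sq \<psi> x = y" if "y > 0" for y
    using that pos_order_iso_pos[OF \<Psi>] by (intro exI[of _ "1 / \<Psi> (1 / y)"]) (simp add: Theta_sq_recip)
qed (rule Theta_sq_less)

lemma pos_order_iso_Theta: "pos_order_iso (Theta \<psi>)"
proof (rule pos_order_isoI)
  show "Theta \<psi> x > 0" if "x > 0" for x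
    using that by (simp add: Theta_eq_sqrt_Theta_sq pos_order_iso_pos[OF pos_order_iso_Theta_sq])
  show "\<exists>x>0. Theta \<psi> x = y" if "y > 0" for y
    using that pos_order_iso_pos[OF \<Psi>] by (intro exI[of _ "1 / \<Psi> (1 / y\<^sup>2)"]) (simp add: Theta_recip)
qed (simp add: Theta_eq_sqrt_Theta_sq Theta_sq_less)

lemma pos_inv_Theta_sq: "x > 0 \<Longrightarrow> pos_inv (Theta_sq \<psi>) x = 1 / \<Psi> (1 / x)"
  by (rule pos_inv_eqI[OF pos_order_iso_Theta_sq]) (simp_all add: pos_order_iso_pos[OF \<Psi>] Theta_sq_recip)

lemma pos_inv_Theta: "x > 0 \<Longrightarrow> pos_inv (Theta \<psi>) x = 1 / \<Psi> (1 / x\<^sup>2)"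
  by (rule pos_inv_eqI[OF pos_order_iso_Theta]) (simp_all add: pos_order_iso_pos[OF \<Psi>] Theta_recip)

text \<open>At this argument the inverse of \<open>\<Psi>\<close> in \<open>psi_bar\<close> is
  evaluated at \<open>\<Psi> (1 / x)\<close> and returns \<open>1 / x\<close>. The coincidence, the
  transfer of concavity and the growth condition all rest on this formula.\<close>

lemma psi_bar_at_recip: "x > 0 \<Longrightarrow> \<psi> (1 / \<Psi> (1 / x)) = sqrt (x * \<Psi> (1 / x))"
  using pos_order_iso_pos[OF \<Psi>]
  by (simp add: \<psi> psi_bar_def pos_inv_f[OF \<Psi>] real_sqrt_mult real_sqrt_divide)

lemma coincidence_psi_bar: "coincidence \<Psi> \<psi>"
  unfolding coincidence_def
proof (intro allI impI)
  fix R \<delta> :: real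
  assume pos: "R > 0" "\<delta> > 0"
  \<comment> \<open>This is \<open>psi_bar_at_recip\<close> at the square of
    \<open>\<delta> / R\<close>, because \<open>Theta\<close> is the root of
    \<open>Theta_sq\<close>.\<close>
  have "\<psi> (pos_inv (Theta \<psi>) (\<delta> / R)) = sqrt ((\<delta> / R)\<^sup>2 * \<Psi> (1 / (\<delta> / R)\<^sup>2))"
    using pos by (simp only: pos_inv_Theta divide_pos_pos psi_bar_at_recip zero_less_power)
  also have "\<dots> = (\<delta> / R) * sqrt (\<Psi> (R\<^sup>2 / \<delta>\<^sup>2))"
    using pos by (simp add: real_sqrt_mult power_divide real_sqrt_divide)
  finally show "\<delta> * sqrt (\<Psi> (R\<^sup>2 / \<delta>\<^sup>2)) = R * \<psi> (pos_inv (Theta \<psi>) (\<delta> / R))"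
    using pos by simp
qed

lemma concave_psi_bar_sq_iff:
  "concave_on {0<..} (\<lambda>t. (\<psi> (pos_inv (Theta_sq \<psi>) t))\<^sup>2) \<longleftrightarrow> concave_on {0<..} \<Psi>"
proof -
  have "(\<psi> (pos_inv (Theta_sq \<psi>) t))\<^sup>2 = t * \<Psi> (1 / t)" if "t \<in> {0<..}" for t
    using that pos_order_iso_pos[OF \<Psi>, of "1 / t"] by (simp add: pos_inv_Theta_sq psi_bar_at_recip)
  then have "concave_on {0<..} (\<lambda>t. (\<psi> (pos_inv (Theta_sq \<psi>) t))\<^sup>2) \<longleftrightarrow>
      concave_on {0<..} (\<lambda>t. t * \<Psi> (1 / t))"
    by (rule concave_on_cong)
  then show ?thesis
    by (simp only: concave_on_perspective_iff)
qed

end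

section \<open>The rate function of a concave \<open>\<Psi>\<close>\<close>

lemma recip_at_right_0: "filterlim (\<lambda>t::real. 1 / t) at_top (at_right 0)"
  by (simp add: filterlim_inverse_at_top_right flip: inverse_eq_divide)

lemma recip_at_top: "filterlim (\<lambda>t::real. 1 / t) (at_right 0) at_top"
  by (simp add: filterlim_inverse_at_right_top flip: inverse_eq_divide)

text \<open>With \<open>x = pos_inv \<Psi> (1 / t)\<close>, the square of
  \<open>psi_bar \<Psi> t\<close> is \<open>\<Psi> x / x\<close>. As \<open>t\<close> increases,
  \<open>x\<close> decreases, so the antitone ratio of a concave function gives monotonicity; as
  \<open>t\<close> tends to 0, \<open>x\<close> tends to infinity and the growth condition gives the
  limit.\<close>

lemma rate_function_psi_bar:
  assumes \<Psi>: "pos_order_iso \<Psi>" and conc: "concave_on {0<..} \<Psi>"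
    and lim: "((\<lambda>x. \<Psi> x / x) \<longlongrightarrow> 0) at_top"
  shows "rate_function (psi_bar \<Psi>)"
  unfolding rate_function_def index_function_def
proof (intro conjI allI impI)
  note iso_inv = pos_order_iso_pos_inv[OF \<Psi>]
  have psi_bar_eq: "psi_bar \<Psi> t = sqrt (\<Psi> (pos_inv \<Psi> (1 / t)) / pos_inv \<Psi> (1 / t))" if "t > 0" for t
    using that by (simp add: psi_bar_def f_pos_inv[OF \<Psi>] real_sqrt_divide real_sqrt_mult)
  show "continuous_on {0<..} (psi_bar \<Psi>)"
    unfolding psi_bar_def
    by (intro continuous_intros continuous_on_compose2[OF pos_order_iso_continuous[OF iso_inv]])
      (auto simp: pos_inv_pos[OF \<Psi>] less_imp_neq[THEN not_sym])
  show "psi_bar \<Psi> t > 0" if "t > 0" for t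
    using \<Psi> that by (rule psi_bar_pos)
  show "mono_on {0<..} (psi_bar \<Psi>)"
  proof (rule mono_onI)
    fix s t :: real
    assume "s \<in> {0<..}" "t \<in> {0<..}" "s \<le> t"
    then have st: "0 < s" "0 < t" "\<not> 1 / s < 1 / t"
      by (auto simp: divide_simps)
    then have "pos_inv \<Psi> (1 / t) \<le> pos_inv \<Psi> (1 / s)"
      using pos_order_iso_less_iff[OF iso_inv, of "1 / s" "1 / t"] by simp
    then show "psi_bar \<Psi> s \<le> psi_bar \<Psi> t"
      using st concave_on_pos_ratio_antimono[OF conc pos_order_iso_pos[OF \<Psi>]]
      by (simp add: psi_bar_eq pos_inv_pos[OF \<Psi>])
  qed
  have "filterlim (\<lambda>t. pos_inv \<Psi> (1 / t)) at_top (at_right 0)"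
    by (rule filterlim_compose[OF pos_order_iso_at_top[OF iso_inv] recip_at_right_0])
  from tendsto_real_sqrt[OF filterlim_compose[OF lim this]]
  have "((\<lambda>t. sqrt (\<Psi> (pos_inv \<Psi> (1 / t)) / pos_inv \<Psi> (1 / t))) \<longlongrightarrow> 0) (at_right 0)"
    by simp
  then show "(psi_bar \<Psi> \<longlongrightarrow> 0) (at_right 0)"
    by (rule Lim_transform_eventually)
      (auto simp: psi_bar_eq intro: eventually_mono[OF eventually_at_right_less])
qed

section \<open>Recovering \<open>\<Psi>\<close> from a rate function\<close>

lemma pos_order_iso_Theta_sq_rate:
  assumes "rate_function \<psi>"
  shows "pos_order_iso (Theta_sq \<psi>)"
proof (rule pos_order_iso_of_limits)
  have cont: "continuous_on {0<..} \<psi>" and pos: "\<And>t. t > 0 \<Longrightarrow> \<psi> t > 0"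
    and mono: "\<And>s t. 0 < s \<Longrightarrow> s \<le> t \<Longrightarrow> \<psi> s \<le> \<psi> t" and lim: "(\<psi> \<longlongrightarrow> 0) (at_right 0)"
    using assms by (auto simp: rate_function_def index_function_def mono_on_def)
  have eq: "Theta_sq \<psi> t = t * (\<psi> t)\<^sup>2" if "t > 0" for t
    using that by (simp add: Theta_sq_def Theta_def power_mult_distrib)
  show "continuous_on {0<..} (Theta_sq \<psi>)"
    unfolding Theta_sq_def Theta_def by (intro continuous_intros cont)
  show "Theta_sq \<psi> t > 0" if "t > 0" for t
    using that pos[of t] by (simp add: eq)
  \<comment> \<open>The rate function may be constant on intervals; strictness comes from the factor
    \<open>t\<close>.\<close>
  show "strict_mono_on {0<..} (Theta_sq \<psi>)"
  proof (rule strict_mono_onI)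
    fix s t :: real
    assume "s \<in> {0<..}" "t \<in> {0<..}" "s < t"
    then have "0 < s" "s < t" "0 < (\<psi> s)\<^sup>2" "(\<psi> s)\<^sup>2 \<le> (\<psi> t)\<^sup>2"
      using pos[of s] mono[of s t] by (simp_all add: power_mono)
    then show "Theta_sq \<psi> s < Theta_sq \<psi> t"
      by (simp add: eq mult_less_le_imp_less)
  qed
  have "((\<lambda>t. t * (\<psi> t)\<^sup>2) \<longlongrightarrow> 0 * 0\<^sup>2) (at_right 0)"
    by (intro tendsto_intros lim)
  then have "((\<lambda>t. t * (\<psi> t)\<^sup>2) \<longlongrightarrow> 0) (at_right 0)"
    by simp
  then show "(Theta_sq \<psi> \<longlongrightarrow> 0) (at_right 0)"
    by (rule Lim_transform_eventually)
      (auto simp: eq intro: eventually_mono[OF eventually_at_right_less])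
  \<comment> \<open>A linear minorant of \<open>Theta_sq \<psi>\<close> for
    \<open>t \<ge> 1\<close>, since \<open>\<psi>\<close> stays above \<open>\<psi> 1\<close> there;
    \<open>\<psi>\<close> itself may be bounded.\<close>
  have "filterlim (\<lambda>t. (\<psi> 1)\<^sup>2 * t) at_top at_top"
    using pos[of 1] by (intro filterlim_tendsto_pos_mult_at_top[OF tendsto_const _ filterlim_ident]) simp
  moreover have "\<forall>\<^sub>F t in at_top. (\<psi> 1)\<^sup>2 * t \<le> Theta_sq \<psi> t"
    using eventually_ge_at_top[of 1]
  proof (rule eventually_mono)
    fix t :: real
    assume "1 \<le> t"
    then show "(\<psi> 1)\<^sup>2 * t \<le> Theta_sq \<psi> t"
      using pos[of 1] mono[of 1 t] by (simp add: eq mult.commute power_mono)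
  qed
  ultimately show "filterlim (Theta_sq \<psi>) at_top at_top"
    by (rule filterlim_at_top_mono)
qed

text \<open>Conjugation by the reciprocal reverses the order twice.\<close>

lemma pos_order_iso_recip:
  assumes "pos_order_iso f"
  shows "pos_order_iso (\<lambda>x. 1 / f (1 / x))"
proof (rule pos_order_isoI)
  show "1 / f (1 / x) > 0" if "x > 0" for x
    using that by (simp add: pos_order_iso_pos[OF assms])
  show "1 / f (1 / x) < 1 / f (1 / y)" if "0 < x" "x < y" for x y
    using that pos_order_iso_less_iff[OF assms, of "1 / y" "1 / x"] pos_order_iso_pos[OF assms, of "1 / y"]
    by (simp add: frac_less2)
  show "\<exists>x>0. 1 / f (1 / x) = y" if "y > 0" for y
    using that
    by (intro exI[of _ "1 / pos_inv f (1 / y)"]) (simp add: pos_inv_pos[OF assms] f_pos_inv[OF assms])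
qed

text \<open>The solution of the defining equation: squaring it gives
  \<open>pos_inv \<Psi> (1 / t) = 1 / Theta_sq \<psi> t\<close>, so \<open>\<Psi>\<close> must send
  \<open>1 / Theta_sq \<psi> t\<close> to \<open>1 / t\<close>.\<close>

definition Psi_of :: "(real \<Rightarrow> real) \<Rightarrow> real \<Rightarrow> real" where
  "Psi_of \<psi> x = 1 / pos_inv (Theta_sq \<psi>) (1 / x)"

lemma pos_order_iso_Psi_of: "rate_function \<psi> \<Longrightarrow> pos_order_iso (Psi_of \<psi>)"
  unfolding Psi_of_def
  by (intro pos_order_iso_recip pos_order_iso_pos_inv pos_order_iso_Theta_sq_rate)

text \<open>\<open>Psi_of \<psi>\<close> sends \<open>1 / Theta_sq \<psi> t\<close> to
  \<open>1 / t\<close>, which identifies its inverse at \<open>1 / t\<close>. The facts about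
  \<open>Theta\<close> and the coincidence thereby become available for a given rate
  function.\<close>

lemma psi_bar_Psi_of:
  assumes \<psi>: "rate_function \<psi>" and t: "t > 0"
  shows "\<psi> t = psi_bar (Psi_of \<psi>) t"
proof -
  have "\<psi> t > 0"
    using \<psi> t by (simp add: rate_function_def index_function_def)
  have "Theta_sq \<psi> t > 0"
    using t by (rule pos_order_iso_pos[OF pos_order_iso_Theta_sq_rate[OF \<psi>]])
  then have "pos_inv (Psi_of \<psi>) (1 / t) = 1 / Theta_sq \<psi> t"
    using t by (intro pos_inv_eqI[OF pos_order_iso_Psi_of[OF \<psi>]])
      (simp_all add: Psi_of_def pos_inv_f[OF pos_order_iso_Theta_sq_rate[OF \<psi>]])
  then show ?thesis
    using t \<open>\<psi> t > 0\<close>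
    by (simp add: psi_bar_def Theta_sq_def Theta_def power_mult_distrib real_sqrt_divide)
qed

lemma limit_conditions_Psi_of:
  assumes \<psi>: "rate_function \<psi>"
  shows "limit_conditions (Psi_of \<psi>)"
  unfolding limit_conditions_def
proof (intro conjI)
  note iso = pos_order_iso_Psi_of[OF \<psi>]
  show "(Psi_of \<psi> \<longlongrightarrow> 0) (at_right 0)" "filterlim (Psi_of \<psi>) at_top at_top"
    using iso by (rule pos_order_iso_at_0, rule pos_order_iso_at_top)
  have "(\<psi> \<longlongrightarrow> 0) (at_right 0)"
    using \<psi> by (simp add: rate_function_def)
  moreover have "filterlim (\<lambda>x. 1 / Psi_of \<psi> x) (at_right 0) at_top"
    by (rule filterlim_compose[OF recip_at_top pos_order_iso_at_top[OF iso]])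
  ultimately have "((\<lambda>x. \<psi> (1 / Psi_of \<psi> x)) \<longlongrightarrow> 0) at_top"
    by (rule filterlim_compose)
  then have "((\<lambda>x. (\<psi> (1 / Psi_of \<psi> x))\<^sup>2) \<longlongrightarrow> 0\<^sup>2) at_top"
    by (rule tendsto_power)
  then have "((\<lambda>x. (\<psi> (1 / Psi_of \<psi> x))\<^sup>2) \<longlongrightarrow> 0) at_top"
    by simp
  \<comment> \<open>The square of \<open>psi_bar_at_recip\<close>, taken at
    \<open>1 / x\<close>.\<close>
  moreover have "\<forall>\<^sub>F x in at_top. (\<psi> (1 / Psi_of \<psi> x))\<^sup>2 = Psi_of \<psi> x / x"
    using eventually_gt_at_top[of 0]
  proof (rule eventually_mono)
    fix x :: real
    assume "0 < x"
    then show "(\<psi> (1 / Psi_of \<psi> x))\<^sup>2 = Psi_of \<psi> x / x"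
      using psi_bar_at_recip[OF iso psi_bar_Psi_of[OF \<psi>], of "1 / x"] pos_order_iso_pos[OF iso, of x]
      by simp
  qed
  ultimately show "((\<lambda>x. Psi_of \<psi> x / x) \<longlongrightarrow> 0) at_top"
    by (rule Lim_transform_eventually)
qed

section \<open>Uniqueness of \<open>\<Psi>\<close> and assembly of both directions\<close>

lemma psi_bar_determines:
  assumes inv: "pos_invertible \<Psi>" "pos_invertible \<Psi>'"
    and eq: "\<And>t. t > 0 \<Longrightarrow> psi_bar \<Psi> t = psi_bar \<Psi>' t" and x: "x > 0"
  shows "\<Psi>' x = \<Psi> x"
proof -
  \<comment> \<open>Equal values of \<open>psi_bar\<close> at \<open>t\<close> force equal inverses
    at \<open>1 / t = \<Psi> x\<close>. Hence the inverse of \<open>\<Psi>'\<close> there is also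
    \<open>x\<close>, and applying \<open>\<Psi>'\<close> finishes.\<close>
  define t where "t = 1 / \<Psi> x"
  have "\<Psi> x > 0"
    using inv x by (auto simp: pos_invertible_def bij_betw_def)
  then have t: "t > 0" "1 / t = \<Psi> x"
    by (simp_all add: t_def)
  have "pos_inv \<Psi> (1 / t) = pos_inv \<Psi>' (1 / t)"
    using eq[OF t(1)] t(1) by (simp add: psi_bar_def)
  moreover have "pos_inv \<Psi> (\<Psi> x) = x"
    using inv x by (auto simp: pos_invertible_def pos_inv_def bij_betw_def)
  moreover have "\<Psi>' (pos_inv \<Psi>' (\<Psi> x)) = \<Psi> x"
    using inv \<open>\<Psi> x > 0\<close> unfolding pos_invertible_def pos_inv_def
    by (simp add: bij_betw_inv_into_right)
  ultimately show ?thesis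
    using t by simp
qed

theorem proposition3p2:
  shows
   "(\<forall>\<Psi>. index_function \<Psi> \<and> concave_on {0<..} \<Psi> \<and> strict_mono_on {0<..} \<Psi> \<and> limit_conditions \<Psi> \<longrightarrow>
       pos_invertible \<Psi> \<and> rate_function (psi_bar \<Psi>) \<and>
       pos_invertible (Theta (psi_bar \<Psi>)) \<and> pos_invertible (Theta_sq (psi_bar \<Psi>)) \<and>
       coincidence \<Psi> (psi_bar \<Psi>) \<and>
       concave_on {0<..} (\<lambda>t. (psi_bar \<Psi> (pos_inv (Theta_sq (psi_bar \<Psi>)) t))\<^sup>2))
    \<and>
    (\<forall>\<psi>. rate_function \<psi> \<longrightarrow>
       pos_invertible (Theta \<psi>) \<and> pos_invertible (Theta_sq \<psi>) \<and>
       (\<exists>\<Psi>. pos_invertible \<Psi> \<and> (\<forall>t>0. \<psi> t = psi_bar \<Psi> t) \<and>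
          index_function \<Psi> \<and> strict_mono_on {0<..} \<Psi> \<and> limit_conditions \<Psi> \<and>
          (\<forall>\<Psi>'. index_function \<Psi>' \<and> pos_invertible \<Psi>' \<and> (\<forall>t>0. \<psi> t = psi_bar \<Psi>' t)
                  \<longrightarrow> (\<forall>x>0. \<Psi>' x = \<Psi> x)) \<and>
          (concave_on {0<..} (\<lambda>t. (\<psi> (pos_inv (Theta_sq \<psi>) t))\<^sup>2) \<longrightarrow>
             concave_on {0<..} \<Psi> \<and> coincidence \<Psi> \<psi>)))"
proof (intro conjI[of "All _"] allI impI)
  fix \<Psi> :: "real \<Rightarrow> real"
  assume A: "index_function \<Psi> \<and> concave_on {0<..} \<Psi> \<and> strict_mono_on {0<..} \<Psi> \<and> limit_conditions \<Psi>"
  then have iso: "pos_order_iso \<Psi>"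
    by (intro pos_order_iso_of_limits) (auto simp: index_function_def limit_conditions_def)
  show "pos_invertible \<Psi> \<and> rate_function (psi_bar \<Psi>) \<and>
      pos_invertible (Theta (psi_bar \<Psi>)) \<and> pos_invertible (Theta_sq (psi_bar \<Psi>)) \<and>
      coincidence \<Psi> (psi_bar \<Psi>) \<and>
      concave_on {0<..} (\<lambda>t. (psi_bar \<Psi> (pos_inv (Theta_sq (psi_bar \<Psi>)) t))\<^sup>2)"
    using A iso
    by (auto simp: limit_conditions_def concave_psi_bar_sq_iff coincidence_psi_bar
        intro: rate_function_psi_bar pos_order_iso_imp_invertible pos_order_iso_Theta pos_order_iso_Theta_sq)
next
  fix \<psi> :: "real \<Rightarrow> real"
  assume \<psi>: "rate_function \<psi>"
  note iso = pos_order_iso_Psi_of[OF \<psi>] and eq = psi_bar_Psi_of[OF \<psi>]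
  note inv = pos_order_iso_imp_invertible[OF iso]
  show "pos_invertible (Theta \<psi>) \<and> pos_invertible (Theta_sq \<psi>) \<and>
      (\<exists>\<Psi>. pos_invertible \<Psi> \<and> (\<forall>t>0. \<psi> t = psi_bar \<Psi> t) \<and>
         index_function \<Psi> \<and> strict_mono_on {0<..} \<Psi> \<and> limit_conditions \<Psi> \<and>
         (\<forall>\<Psi>'. index_function \<Psi>' \<and> pos_invertible \<Psi>' \<and> (\<forall>t>0. \<psi> t = psi_bar \<Psi>' t)
                 \<longrightarrow> (\<forall>x>0. \<Psi>' x = \<Psi> x)) \<and>
         (concave_on {0<..} (\<lambda>t. (\<psi> (pos_inv (Theta_sq \<psi>) t))\<^sup>2) \<longrightarrow>
            concave_on {0<..} \<Psi> \<and> coincidence \<Psi> \<psi>))"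
  \<comment> \<open>By \<open>iso\<close> and \<open>eq\<close>, the pair
    \<open>Psi_of \<psi>\<close>, \<open>\<psi>\<close> is an instance of the situation of the first
    direction, so invertibility, the concavity equivalence and the coincidence are read off from
    there.\<close>
  proof (intro conjI exI[of _ "Psi_of \<psi>"] allI impI)
    show "pos_invertible (Theta \<psi>)" "pos_invertible (Theta_sq \<psi>)"
      using pos_order_iso_Theta[OF iso eq] pos_order_iso_Theta_sq[OF iso eq]
      by (simp_all add: pos_order_iso_imp_invertible)
    show "strict_mono_on {0<..} (Psi_of \<psi>)"
      using iso by (simp add: pos_order_iso_def)
    show "\<Psi>' x = Psi_of \<psi> x"
      if "index_function \<Psi>' \<and> pos_invertible \<Psi>' \<and> (\<forall>t>0. \<psi> t = psi_bar \<Psi>' t)" "x > 0" for \<Psi>' x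
      by (rule psi_bar_determines[OF inv]) (use that eq in auto)
    show "concave_on {0<..} (Psi_of \<psi>)"
      if "concave_on {0<..} (\<lambda>t. (\<psi> (pos_inv (Theta_sq \<psi>) t))\<^sup>2)"
      using that by (simp add: concave_psi_bar_sq_iff[OF iso eq])
    show "coincidence (Psi_of \<psi>) \<psi>"
      by (rule coincidence_psi_bar[OF iso eq])
  qed (use inv eq pos_order_iso_index_function[OF iso] limit_conditions_Psi_of[OF \<psi>] in auto)
qed

end
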